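(* Let $n\ge 1$ be an integer, $T>0$, $\delta\in(0,1)$, let $\mathcal{D}=\{(t_0,\dots,t_n)\in\mathbb{R}^{n+1}: t_0=0,\ t_n=T,\ 0\le t_i\le T,\ t_i\le t_{i+1}\text{ for all }i\}$ and $L(t_0,\dots,t_n)=\sum_{0\le j<i\le n}\delta^{t_i-t_j}$. Then $L$ admits a unique minimum in $\mathcal{D}$. *)

theory Defs
  imports Complex_Main "HOL-Library.FuncSet"
begin

text \<open>
  A point of $\mathbb{R}^{n+1}$ is a function on the indices \<open>{0..n}\<close>; requiring it to be
  \<open>extensional\<close> fixes its values outside \<open>{0..n}\<close>, so that equality of points is equality of
  their $n+1$ coordinates.
\<close>

definition D_set :: "nat \<Rightarrow> real \<Rightarrow> (nat \<Rightarrow> real) set" where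
  "D_set n T = {t \<in> extensional {0..n}.
     t 0 = 0 \<and> t n = T \<and> (\<forall>i\<le>n. 0 \<le> t i \<and> t i \<le> T) \<and> (\<forall>i<n. t i \<le> t (i + 1))}"

definition L_fun :: "real \<Rightarrow> nat \<Rightarrow> (nat \<Rightarrow> real) \<Rightarrow> real" where
  "L_fun \<delta> n t = (\<Sum>(i, j) \<in> {(i, j). j < i \<and> i \<le> n}. \<delta> powr (t i - t j))"

end

theory Submission
  imports Defs "HOL-Analysis.Function_Topology" "HOL-Analysis.Line_Segment"
begin

text \<open>
  The set \<open>D_set n T\<close> is compact, being a closed subset of a product of intervals, and \<open>L_fun\<close> is
  continuous, so a minimiser exists. It is unique because \<open>L_fun\<close> is strictly midpoint convex: every
  summand is an exponential of a linear form, hence convex by the inequality of arithmetic and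
  geometric means, and the summand \<open>\<delta> powr (t i - t 0)\<close> is strictly so between two points of
  \<open>D_set n T\<close> that differ in coordinate \<open>i\<close>, since \<open>t 0 = 0\<close> there.
\<close>

lemma continuous_attains_unique_inf:
  fixes f :: "'a::topological_space \<Rightarrow> 'b::linorder_topology"
  assumes "compact A" "A \<noteq> {}" "continuous_on A f"
    and below_max: "\<And>x y. x \<in> A \<Longrightarrow> y \<in> A \<Longrightarrow> x \<noteq> y \<Longrightarrow> \<exists>z\<in>A. f z < max (f x) (f y)"
  shows "\<exists>!x. x \<in> A \<and> (\<forall>y\<in>A. f x \<le> f y)"
proof (rule ex_ex1I)
  show "\<exists>x. x \<in> A \<and> (\<forall>y\<in>A. f x \<le> f y)"
    using continuous_attains_inf[OF assms(1-3)] by blast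
next
  fix x y
  assume x: "x \<in> A \<and> (\<forall>z\<in>A. f x \<le> f z)" and y: "y \<in> A \<and> (\<forall>z\<in>A. f y \<le> f z)"
  show "x = y"
  proof (rule ccontr)
    assume "x \<noteq> y"
    then obtain z where "z \<in> A" "f z < max (f x) (f y)"
      using below_max x y by blast
    then show False
      using x y by (meson leD less_max_iff_disj)
  qed
qed

lemma compact_PiE:
  fixes S :: "'i \<Rightarrow> 'a::topological_space set"
  assumes "\<And>i. i \<in> I \<Longrightarrow> compact (S i)"
  shows "compact (PiE I S)"
proof -
  define S' where "S' i = (if i \<in> I then S i else {undefined})" for i
  have "compactin (product_topology (\<lambda>i. euclidean) UNIV) (PiE UNIV S')"
    using assms by (simp add: compactin_PiE S'_def)
  moreover have "PiE I S = PiE UNIV S'"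
    by (auto simp: S'_def PiE_iff extensional_def split: if_splits)
  ultimately show ?thesis
    by (simp add: euclidean_product_topology)
qed

lemma midpoint_diff:
  fixes a b c d :: "'a::real_vector"
  shows "midpoint a b - midpoint c d = midpoint (a - c) (b - d)"
  by (simp add: midpoint_def algebra_simps)

lemma arith_geo_mean_sqrt_less:
  fixes x y :: real
  assumes "x \<ge> 0" "y \<ge> 0" "x \<noteq> y"
  shows "sqrt (x * y) < (x + y) / 2"
proof -
  have "0 < (sqrt x - sqrt y)\<^sup>2"
    using assms by simp
  also have "\<dots> = x + y - 2 * sqrt (x * y)"
    using assms by (simp add: power2_diff real_sqrt_mult)
  finally show ?thesis
    by simp
qed

lemma powr_midpoint:
  fixes a x y :: real
  assumes "a \<ge> 0"
  shows "a powr midpoint x y = sqrt (a powr x * a powr y)"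
proof -
  have "midpoint x y = x / 2 + y / 2"
    by (simp add: midpoint_def field_simps)
  then show ?thesis
    using assms by (simp add: powr_add real_sqrt_mult powr_half_sqrt_powr)
qed

lemma powr_midpoint_le:
  fixes a x y :: real
  assumes "a \<ge> 0"
  shows "a powr midpoint x y \<le> midpoint (a powr x) (a powr y)"
  using arith_geo_mean_sqrt[of "a powr x" "a powr y"]
  unfolding powr_midpoint[OF assms] by (simp add: midpoint_def)

lemma powr_midpoint_less:
  fixes a x y :: real
  assumes "a > 0" "a \<noteq> 1" "x \<noteq> y"
  shows "a powr midpoint x y < midpoint (a powr x) (a powr y)"
proof -
  have "a powr x \<noteq> a powr y"
    using assms by (simp add: powr_inj)
  then have "sqrt (a powr x * a powr y) < (a powr x + a powr y) / 2"
    by (intro arith_geo_mean_sqrt_less) simp_all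
  with \<open>a > 0\<close> show ?thesis
    unfolding powr_midpoint[OF less_imp_le[OF \<open>a > 0\<close>]] by (simp add: midpoint_def)
qed

lemma sum_powr_midpoint_less:
  fixes x y :: "'i \<Rightarrow> real"
  assumes "finite A" "a > 0" "a \<noteq> 1" "k \<in> A" "x k \<noteq> y k"
  shows "(\<Sum>i\<in>A. a powr midpoint (x i) (y i)) < midpoint (\<Sum>i\<in>A. a powr x i) (\<Sum>i\<in>A. a powr y i)"
proof -
  have "(\<Sum>i\<in>A. a powr midpoint (x i) (y i)) < (\<Sum>i\<in>A. midpoint (a powr x i) (a powr y i))"
    using assms by (intro sum_strict_mono_ex1) (auto intro: powr_midpoint_le powr_midpoint_less)
  also have "\<dots> = midpoint (\<Sum>i\<in>A. a powr x i) (\<Sum>i\<in>A. a powr y i)"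
    by (simp add: midpoint_def sum_distrib_left flip: sum.distrib)
  finally show ?thesis .
qed

definition midpoint_on :: "'i set \<Rightarrow> ('i \<Rightarrow> 'a::real_vector) \<Rightarrow> ('i \<Rightarrow> 'a) \<Rightarrow> 'i \<Rightarrow> 'a" where
  "midpoint_on I s t = (\<lambda>i\<in>I. midpoint (s i) (t i))"

lemma D_set_eq_PiE_Int:
  "D_set n T = PiE {0..n} (\<lambda>_. {0..T}) \<inter> {t. t 0 = 0 \<and> t n = T \<and> (\<forall>i<n. t i \<le> t (i + 1))}"
  by (auto simp: D_set_def PiE_iff extensional_def)

lemma compact_D_set: "compact (D_set n T)"
proof -
  have "closed {t :: nat \<Rightarrow> real. t 0 = 0 \<and> t n = T \<and> (\<forall>i<n. t i \<le> t (i + 1))}"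
    by (intro closed_Collect_conj closed_Collect_all closed_Collect_imp closed_Collect_eq
        closed_Collect_le continuous_on_product_coordinates continuous_on_const) auto
  then show ?thesis
    by (simp add: D_set_eq_PiE_Int compact_Int_closed compact_PiE)
qed

lemma D_set_nonempty:
  assumes "n \<ge> 1" "T \<ge> 0"
  shows "D_set n T \<noteq> {}"
proof -
  have "(\<lambda>i\<in>{0..n}. if i = 0 then 0 else T) \<in> D_set n T"
    using assms by (auto simp: D_set_def)
  then show ?thesis by blast
qed

lemma midpoint_on_in_D_set:
  assumes "s \<in> D_set n T" "t \<in> D_set n T"
  shows "midpoint_on {0..n} s t \<in> D_set n T"
proof -
  have "s i + t i \<le> T * 2" if "i \<le> n" for i
    using assms that by (fastforce simp: D_set_def)
  then show ?thesis
    using assms by (auto simp: D_set_def midpoint_on_def midpoint_def intro: add_mono)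
qed

lemma D_set_neqE:
  assumes "s \<in> D_set n T" "t \<in> D_set n T" "s \<noteq> t"
  obtains i where "0 < i" "i \<le> n" "s i - s 0 \<noteq> t i - t 0"
proof -
  have "s \<in> extensional {0..n}" "t \<in> extensional {0..n}" and zero: "s 0 = 0" "t 0 = 0"
    using assms(1,2) by (auto simp: D_set_def)
  then obtain i where "i \<le> n" "s i \<noteq> t i"
    using \<open>s \<noteq> t\<close> extensionalityI by (metis atLeastAtMost_iff)
  moreover from this have "0 < i"
    using zero by (metis gr0I)
  ultimately show ?thesis
    using that zero by simp
qed

lemma continuous_on_L_fun:
  assumes "\<delta> > 0"
  shows "continuous_on S (L_fun \<delta> n)"
proof -
  have "continuous_on UNIV (L_fun \<delta> n)"
    unfolding L_fun_def case_prod_beta using assms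
    by (intro continuous_on_sum continuous_on_powr continuous_on_diff continuous_on_const
        continuous_on_product_coordinates) auto
  then show ?thesis
    by (rule continuous_on_subset) simp
qed

lemma L_fun_midpoint_on_less:
  assumes "\<delta> > 0" "\<delta> \<noteq> 1" and "j < i" "i \<le> n" "s i - s j \<noteq> t i - t j"
  shows "L_fun \<delta> n (midpoint_on {0..n} s t) < midpoint (L_fun \<delta> n s) (L_fun \<delta> n t)"
proof -
  define P where "P = {(i, j). j < i \<and> i \<le> n}"
  define gap where "gap u = (\<lambda>(i, j). u i - u j)" for u :: "nat \<Rightarrow> real"
  have L_fun_gap: "L_fun \<delta> n u = (\<Sum>p\<in>P. \<delta> powr gap u p)" for u
    by (simp add: L_fun_def P_def gap_def case_prod_beta)
  have "gap (midpoint_on {0..n} s t) p = midpoint (gap s p) (gap t p)" if "p \<in> P" for p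
    using that by (auto simp: gap_def P_def midpoint_on_def midpoint_diff)
  moreover have "finite P"
    by (rule finite_subset[of _ "{..n} \<times> {..n}"]) (auto simp: P_def)
  moreover have "(i, j) \<in> P" "gap s (i, j) \<noteq> gap t (i, j)"
    using assms by (auto simp: P_def gap_def)
  ultimately show ?thesis
    using sum_powr_midpoint_less[of P \<delta> "(i, j)" "gap s" "gap t"] assms
    by (simp add: L_fun_gap)
qed

theorem theorem1:
  fixes n :: nat and T \<delta> :: real
  assumes "n \<ge> 1" and "T > 0" and "0 < \<delta>" and "\<delta> < 1"
  shows "\<exists>!t. t \<in> D_set n T \<and> (\<forall>s \<in> D_set n T. L_fun \<delta> n t \<le> L_fun \<delta> n s)"
proof (rule continuous_attains_unique_inf)
  show "compact (D_set n T)" "D_set n T \<noteq> {}" "continuous_on (D_set n T) (L_fun \<delta> n)"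
    using assms by (simp_all add: compact_D_set D_set_nonempty continuous_on_L_fun)
next
  fix s t
  assume s: "s \<in> D_set n T" and t: "t \<in> D_set n T" and "s \<noteq> t"
  then obtain i where "0 < i" "i \<le> n" "s i - s 0 \<noteq> t i - t 0"
    by (rule D_set_neqE)
  then have "L_fun \<delta> n (midpoint_on {0..n} s t) < midpoint (L_fun \<delta> n s) (L_fun \<delta> n t)"
    using assms by (intro L_fun_midpoint_on_less) auto
  also have "\<dots> \<le> max (L_fun \<delta> n s) (L_fun \<delta> n t)"
    by (simp add: midpoint_def)
  finally show "\<exists>u\<in>D_set n T. L_fun \<delta> n u < max (L_fun \<delta> n s) (L_fun \<delta> n t)"
    using midpoint_on_in_D_set[OF s t] by blast
qed

end
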